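(* Let $p>7$ be a prime and let $J=\{(a_i,b_i,c_i) : 1\le i\le 9p-3\}$ be a sequence in $Z_p^3$ of length $9p-3$. Then either $N^{p}(J)>0$, or at least six of the seven numbers $N^{ip}(J)$, $2\le i\le 8$, are not congruent to $0$ modulo $p$.
   Context: $Z_p=\mathbb{Z}/p\mathbb{Z}$. A sequence in $Z_p^3$ is a finite sequence of elements in which repetitions are allowed and order is irrelevant. A subsequence of $J$ is obtained by choosing a subset of the indices of $J$. For a sequence $J$ in $Z_p^3$ and an integer $k\ge 1$, $N^{kp}(J)$ is the number of subsequences of $J$ of length $kp$ (counted as subsets of the index set) whose sum is $0$ in $Z_p^3$. *)

theory Defs
  imports "HOL-Computational_Algebra.Primes" "HOL-Number_Theory.Cong"
begin

text \<open>
  An element of \<open>(\<int>/p\<int>)\<^sup>3\<close> is given by a triple of integer representatives, and equality in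
  \<open>\<int>/p\<int>\<close> is congruence modulo \<open>p\<close>. A sequence is a list of such triples; its order plays no
  role, and subsequences are sets of positions, so equal entries at different positions are
  counted separately.
\<close>

definition zero_sum_mod :: "nat \<Rightarrow> (int \<times> int \<times> int) list \<Rightarrow> nat set \<Rightarrow> bool" where
  "zero_sum_mod p J I \<longleftrightarrow>
     [(\<Sum>i\<in>I. fst (J ! i)) = 0] (mod int p) \<and>
     [(\<Sum>i\<in>I. fst (snd (J ! i))) = 0] (mod int p) \<and>
     [(\<Sum>i\<in>I. snd (snd (J ! i))) = 0] (mod int p)"

definition num_zero_sum :: "nat \<Rightarrow> nat \<Rightarrow> (int \<times> int \<times> int) list \<Rightarrow> nat" where
  "num_zero_sum p m J = card {I. I \<subseteq> {..<length J} \<and> card I = m \<and> zero_sum_mod p J I}"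

end

theory Submission
  imports Defs "HOL-Number_Theory.Residues"
begin

text \<open>
  Functions of a finite set \<open>I \<subseteq> U\<close> that are polynomials of degree less than \<open>card U\<close> in the
  indicator variables of \<open>I\<close> have alternating sum \<open>0\<close> over all \<open>I\<close>. By Fermat, the condition
  that \<open>I\<close> is a zero-sum subsequence of length divisible by \<open>p\<close> is, modulo \<open>p\<close>, a polynomial of
  degree \<open>4 * (p - 1)\<close>, and \<open>card I choose p\<close>, of degree \<open>p\<close>, is congruent to \<open>k\<close> when
  \<open>card I = k * p\<close>. As \<open>4 * (p - 1) + 5 * p < 9 * p - 3\<close>, this gives
  \<open>\<Sum>k\<le>8. (-1) ^ k * Q k * N k \<equiv> 0\<close> for every polynomial \<open>Q\<close> of degree at most \<open>5\<close>,
  where \<open>N k\<close> counts the zero-sum subsequences of length \<open>k * p\<close>. If at most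
  five of \<open>N 2, \<dots>, N 8\<close> were nonzero modulo \<open>p\<close> and \<open>N 1 = 0\<close>, the choice of \<open>Q\<close> vanishing
  at these indices would leave only the term \<open>Q 0 * N 0 = Q 0\<close>, which is not divisible by \<open>p\<close>.
\<close>

section \<open>Polynomials in the indicator variables of a set\<close>

text \<open>The factor \<open>of_bool (T \<subseteq> I)\<close> is the product of the indicator
  variables over \<open>T\<close>, so these are the multilinear integer polynomials;
  \<open>d\<close> is only an upper bound on the degree.\<close>

inductive set_poly :: "'a set \<Rightarrow> nat \<Rightarrow> ('a set \<Rightarrow> int) \<Rightarrow> bool" for U d where
  monom: "T \<subseteq> U \<Longrightarrow> card T \<le> d \<Longrightarrow> set_poly U d (\<lambda>I. c * of_bool (T \<subseteq> I))"
| add: "set_poly U d f \<Longrightarrow> set_poly U d g \<Longrightarrow> set_poly U d (\<lambda>I. f I + g I)"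

lemma set_poly_const: "set_poly U d (\<lambda>I. c)"
  using set_poly.monom[of "{}" U d c] by simp

lemma set_poly_sum:
  assumes "finite A" "\<And>x. x \<in> A \<Longrightarrow> set_poly U d (f x)"
  shows "set_poly U d (\<lambda>I. \<Sum>x\<in>A. f x I)"
  using assms by (induction A rule: finite_induct) (auto intro: set_poly_const set_poly.add)

text \<open>Indicator variables are idempotent, so the monomials of \<open>T\<close> and
  \<open>S\<close> multiply to that of \<open>T \<union> S\<close>, whose size is at most the sum of
  the two sizes.\<close>

lemma set_poly_mult_monom:
  assumes "set_poly U e g" "T \<subseteq> U" "card T \<le> d"
  shows "set_poly U (d + e) (\<lambda>I. c * of_bool (T \<subseteq> I) * g I)"
  using assms(1)
proof induction
  case (monom S b)
  have "card (T \<union> S) \<le> d + e"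
    using card_Un_le[of T S] assms(3) monom by linarith
  then have "set_poly U (d + e) (\<lambda>I. c * b * of_bool (T \<union> S \<subseteq> I))"
    using assms(2) monom by (intro set_poly.monom) auto
  then show ?case
    by (simp add: of_bool_conj mult_ac)
next
  case (add f g)
  then show ?case
    using set_poly.add[OF add.IH] by (simp add: distrib_left)
qed

lemma set_poly_mult:
  assumes "set_poly U d f" "set_poly U e g"
  shows "set_poly U (d + e) (\<lambda>I. f I * g I)"
  using assms(1)
proof induction
  case (monom T c)
  then show ?case
    using set_poly_mult_monom[OF assms(2)] by blast
next
  case (add f1 f2)
  then show ?case
    using set_poly.add[OF add.IH] by (simp add: distrib_right)
qed

lemma set_poly_power: "set_poly U d f \<Longrightarrow> set_poly U (n * d) (\<lambda>I. f I ^ n)"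
  by (induction n) (auto intro: set_poly_const set_poly_mult)

lemma set_poly_prod:
  assumes "finite A" "\<And>x. x \<in> A \<Longrightarrow> set_poly U d (f x)"
  shows "set_poly U (card A * d) (\<lambda>I. \<Prod>x\<in>A. f x I)"
  using assms by (induction A rule: finite_induct) (auto intro: set_poly_const set_poly_mult)

lemma set_poly_diff:
  assumes "set_poly U d f" "set_poly U d g"
  shows "set_poly U d (\<lambda>I. f I - g I)"
proof -
  have "set_poly U d (\<lambda>I. - 1 * g I)"
    using set_poly_mult[OF set_poly_const[of U 0 "- 1"] assms(2)] by simp
  then show ?thesis
    using set_poly.add[OF assms(1)] by fastforce
qed

lemma set_poly_linear:
  assumes "finite U"
  shows "set_poly U 1 (\<lambda>I. \<Sum>i\<in>I \<inter> U. c i)"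
proof -
  have "(\<Sum>i\<in>I \<inter> U. c i) = (\<Sum>i\<in>U. c i * of_bool ({i} \<subseteq> I))" for I
    using assms by (intro sum.mono_neutral_cong_left) auto
  moreover have "set_poly U 1 (\<lambda>I. \<Sum>i\<in>U. c i * of_bool ({i} \<subseteq> I))"
    using assms by (intro set_poly_sum set_poly.monom) auto
  ultimately show ?thesis
    by presburger
qed

text \<open>Each \<open>k\<close>-subset \<open>T\<close> of \<open>U\<close> contributes one
  monomial of degree \<open>k\<close>, equal to 1 exactly when \<open>T\<close> lies in
  \<open>I\<close>.\<close>

lemma set_poly_choose:
  assumes "finite U"
  shows "set_poly U k (\<lambda>I. int (card (I \<inter> U) choose k))"
proof -
  let ?A = "{T. T \<subseteq> U \<and> card T = k}"
  have fin: "finite ?A"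
    using assms by simp
  have "int (card (I \<inter> U) choose k) = (\<Sum>T\<in>?A. 1 * of_bool (T \<subseteq> I))" for I
  proof -
    have "card (I \<inter> U) choose k = card {T. T \<subseteq> I \<inter> U \<and> card T = k}"
      using assms by (intro n_subsets [symmetric]) simp
    also have "{T. T \<subseteq> I \<inter> U \<and> card T = k} = {T \<in> ?A. T \<subseteq> I}"
      by auto
    finally show ?thesis
      using fin by (simp add: of_bool_def sum.If_cases Int_def)
  qed
  moreover have "set_poly U k (\<lambda>I. \<Sum>T\<in>?A. 1 * of_bool (T \<subseteq> I))"
    using fin by (intro set_poly_sum set_poly.monom) auto
  ultimately show ?thesis
    by presburger
qed

text \<open>The degree bound makes each \<open>T\<close> a proper subset of \<open>U\<close>, and
  then the sets between \<open>T\<close> and \<open>U\<close> are half of even and half of odd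
  size.\<close>

lemma set_poly_alternating_sum:
  assumes "set_poly U d f" "finite U" "d < card U"
  shows "(\<Sum>I\<in>Pow U. (- 1) ^ card I * f I) = 0"
  using assms(1)
proof induction
  case (monom T c)
  have "T \<subset> U"
    using monom assms(3) by auto
  have "(\<Sum>I\<in>Pow U. (- 1) ^ card I * (c * of_bool (T \<subseteq> I))) =
        (\<Sum>I | I \<subseteq> U \<and> T \<subseteq> I. c * (- 1) ^ card I)"
    using assms(2) by (intro sum.mono_neutral_cong_right) auto
  also have "\<dots> = c * (\<Sum>I | I \<subseteq> U \<and> T \<subseteq> I. (- 1) ^ card I)"
    by (simp add: sum_distrib_left)
  also have "(\<Sum>I | I \<subseteq> U \<and> T \<subseteq> I. (- 1) ^ card I) = (0 :: int)"
    using assms(2) card_subsupersets_even_odd[OF assms(2) \<open>T \<subset> U\<close>]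
    by (intro sum_alternating_cancels) (simp_all add: conj_assoc)
  finally show ?case
    by simp
next
  case (add f g)
  then show ?case
    by (simp add: distrib_left sum.distrib)
qed

section \<open>Congruences modulo a prime\<close>

lemma cong_one_minus_power_prime:
  fixes x :: int
  assumes "prime p"
  shows "[1 - x ^ (p - 1) = of_bool (int p dvd x)] (mod int p)"
proof (cases "int p dvd x")
  case True
  then have "int p dvd x ^ (p - 1)"
    using prime_gt_1_nat[OF assms] by (intro dvd_power_le[of _ _ 1, simplified]) auto
  then show ?thesis
    using True by (simp add: cong_iff_dvd_diff)
next
  case False
  \<comment> \<open>Fermat's theorem is stated for naturals, so \<open>x\<close> is replaced by its
    residue.\<close>
  define a where "a = nat (x mod int p)"
  have p: "p > 0"
    using prime_gt_0_nat[OF assms] .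
  have xa: "[x = int a] (mod int p)"
    using p by (simp add: a_def cong_def)
  then have "\<not> p dvd a"
    using False by (simp add: cong_dvd_iff)
  then have "[int a ^ (p - 1) = 1] (mod int p)"
    using fermat_theorem[OF assms] by (metis cong_int_iff of_nat_1 of_nat_power)
  then have "[x ^ (p - 1) = 1] (mod int p)"
    using cong_pow[OF xa] cong_trans by blast
  then have "[1 - x ^ (p - 1) = 1 - 1] (mod int p)"
    by (intro cong_diff) auto
  then show ?thesis
    using False by simp
qed

text \<open>Split off a block of \<open>p\<close> elements by Vandermonde: \<open>p\<close> divides
  \<open>p choose i\<close> except at \<open>i = 0\<close> and \<open>i = p\<close>, so each block
  adds 1.\<close>

lemma choose_mult_prime_cong:
  assumes "prime p"
  shows "[(k * p) choose p = k] (mod p)"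
proof (induction k)
  case 0
  then show ?case
    using prime_gt_0_nat[OF assms] by (simp add: binomial_eq_0)
next
  case (Suc k)
  have p: "p > 0"
    using prime_gt_0_nat[OF assms] .
  let ?f = "\<lambda>i. (p choose i) * ((k * p) choose (p - i))"
  have "Suc k * p choose p = (\<Sum>i\<le>p. ?f i)"
    using vandermonde[of p "k * p" p] by simp
  also have "[\<dots> = (\<Sum>i\<le>p. if i \<in> {0, p} then ?f i else 0)] (mod p)"
  proof (intro cong_sum)
    fix i assume "i \<in> {..p}"
    then show "[?f i = (if i \<in> {0, p} then ?f i else 0)] (mod p)"
      using dvd_choose_prime[of i p] assms p by (auto simp: cong_0_iff)
  qed
  also have "(\<Sum>i\<le>p. if i \<in> {0, p} then ?f i else 0) = (\<Sum>i\<in>{0, p}. ?f i)"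
    by (intro sum.mono_neutral_cong_right) auto
  also have "\<dots> = (k * p choose p) + 1"
    using p by simp
  also have "[\<dots> = k + 1] (mod p)"
    using Suc.IH by (intro cong_add) auto
  finally show ?case
    by simp
qed

section \<open>Relations between the counts of zero-sum subsequences\<close>

lemma num_zero_sum_0: "num_zero_sum p 0 J = 1"
proof -
  have "{I. I \<subseteq> {..<length J} \<and> card I = 0 \<and> zero_sum_mod p J I} = {{}}"
    by (auto simp: zero_sum_mod_def dest: finite_subset)
  then show ?thesis
    by (simp add: num_zero_sum_def)
qed

text \<open>The weight with root set \<open>S\<close> removes the counts indexed by
  \<open>S\<close>. The lower bound on the length makes the alternating sum vanish; the upper bound
  confines \<open>k\<close> to values below \<open>m\<close>.\<close>

lemma alternating_num_zero_sum:
  fixes S :: "nat set"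
  assumes p: "prime p" and S: "finite S"
    and len: "4 * (p - 1) + card S * p < length J" "length J < m * p"
  shows "[(\<Sum>k<m. (- 1) ^ (k * p) * (\<Prod>s\<in>S. int k - int s) * int (num_zero_sum p (k * p) J)) = 0] (mod int p)"
proof -
  define U where "U = {..<length J}"
  have U: "finite U" "card U = length J"
    by (simp_all add: U_def)
  define lin where "lin c I = 1 - (\<Sum>i\<in>I \<inter> U. c i) ^ (p - 1)" for c :: "nat \<Rightarrow> int" and I
  define Q where "Q I = (\<Prod>s\<in>S. int (card (I \<inter> U) choose p) - int s)" for I
  \<comment> \<open>Three factors test the coordinate sums; the fourth, with all coefficients 1,
    tests whether \<open>p\<close> divides \<open>card I\<close>.\<close>
  define F where "F I = lin (\<lambda>i. fst (J ! i)) I * (lin (\<lambda>i. fst (snd (J ! i))) I *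
    (lin (\<lambda>i. snd (snd (J ! i))) I * (lin (\<lambda>i. 1) I * Q I)))" for I
  define Z where "Z k = {I. I \<subseteq> U \<and> card I = k * p \<and> zero_sum_mod p J I}" for k
  have p0: "p > 0"
    using prime_gt_0_nat[OF p] .
  have finZ: "finite (Z k)" for k
    using U by (simp add: Z_def)

  have lin: "set_poly U (p - 1) (lin c)" for c
    using set_poly_diff[OF set_poly_const set_poly_power[OF set_poly_linear[OF U(1)]]]
    by (simp add: lin_def[abs_def])
  have "set_poly U (card S * p) Q"
    unfolding Q_def[abs_def]
    by (intro set_poly_prod S set_poly_diff set_poly_const set_poly_choose U)
  then have "set_poly U (p - 1 + (p - 1 + (p - 1 + (p - 1 + card S * p)))) F"
    unfolding F_def[abs_def] by (intro set_poly_mult lin)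
  then have "(\<Sum>I\<in>Pow U. (- 1) ^ card I * F I) = 0"
    using len U by (elim set_poly_alternating_sum) linarith+
  moreover have "[(\<Sum>I\<in>Pow U. (- 1) ^ card I * F I) =
      (\<Sum>I\<in>Pow U. (- 1) ^ card I * (of_bool (zero_sum_mod p J I \<and> p dvd card I) * Q I))] (mod int p)"
  proof (intro cong_sum cong_scalar_left)
    fix I assume "I \<in> Pow U"
    then have I: "I \<inter> U = I"
      by auto
    have *: "[lin c I = of_bool ([(\<Sum>i\<in>I. c i) = 0] (mod int p))] (mod int p)" for c
      using cong_one_minus_power_prime[OF p] by (simp add: lin_def I cong_0_iff)
    have "[F I = of_bool ([(\<Sum>i\<in>I. fst (J ! i)) = 0] (mod int p)) *
        (of_bool ([(\<Sum>i\<in>I. fst (snd (J ! i))) = 0] (mod int p)) *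
        (of_bool ([(\<Sum>i\<in>I. snd (snd (J ! i))) = 0] (mod int p)) *
        (of_bool ([(\<Sum>i\<in>I. 1) = 0] (mod int p)) * Q I)))] (mod int p)"
      (is "[_ = ?R] (mod _)")
      unfolding F_def by (intro cong_mult * cong_refl)
    also have "?R = of_bool (zero_sum_mod p J I \<and> p dvd card I) * Q I"
      by (simp add: zero_sum_mod_def cong_0_iff)
    finally show "[F I = of_bool (zero_sum_mod p J I \<and> p dvd card I) * Q I] (mod int p)" .
  qed
  moreover have "(\<Sum>I\<in>Pow U. (- 1) ^ card I * (of_bool (zero_sum_mod p J I \<and> p dvd card I) * Q I)) =
      (\<Sum>I\<in>(\<Union>k<m. Z k). (- 1) ^ card I * Q I)"
  proof (intro sum.mono_neutral_cong_right ballI)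
    show "(\<Union>k<m. Z k) \<subseteq> Pow U"
      by (auto simp: Z_def)
    fix I assume I: "I \<in> Pow U - (\<Union>k<m. Z k)"
    have "\<not> (zero_sum_mod p J I \<and> p dvd card I)"
    proof
      assume *: "zero_sum_mod p J I \<and> p dvd card I"
      then obtain k where k: "card I = k * p"
        by (metis dvdE mult.commute)
      have "card I \<le> card U"
        using I U by (intro card_mono) auto
      then have "k * p < m * p"
        using k len(2) U(2) by linarith
      then show False
        using I k * by (auto simp: Z_def)
    qed
    then show "(- 1) ^ card I * (of_bool (zero_sum_mod p J I \<and> p dvd card I) * Q I) = 0"
      by simp
  qed (use U in \<open>auto simp: Z_def\<close>)
  moreover have "\<dots> = (\<Sum>k<m. \<Sum>I\<in>Z k. (- 1) ^ card I * Q I)"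
    using finZ p0 by (intro sum.UNION_disjoint) (auto simp: Z_def)
  moreover have "[\<dots> = (\<Sum>k<m. \<Sum>I\<in>Z k. (- 1) ^ (k * p) * (\<Prod>s\<in>S. int k - int s))] (mod int p)"
  proof (intro cong_sum)
    fix k I assume "I \<in> Z k"
    then have I: "card I = k * p" "I \<inter> U = I"
      by (auto simp: Z_def)
    have "[int (k * p choose p) = int k] (mod int p)"
      using choose_mult_prime_cong[OF p] by (simp only: cong_int_iff)
    then have "[Q I = (\<Prod>s\<in>S. int k - int s)] (mod int p)"
      unfolding Q_def I by (intro cong_prod cong_diff cong_refl)
    then show "[(- 1) ^ card I * Q I = (- 1) ^ (k * p) * (\<Prod>s\<in>S. int k - int s)] (mod int p)"
      unfolding I by (rule cong_scalar_left)
  qed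
  moreover have "num_zero_sum p (k * p) J = card (Z k)" for k
    by (simp add: num_zero_sum_def Z_def U_def)
  ultimately show ?thesis
    by (simp add: cong_def mult_ac)
qed

theorem theorem3:
  fixes p :: nat and J :: "(int \<times> int \<times> int) list"
  assumes "prime p" and "p > 7" and "length J = 9 * p - 3"
  shows "num_zero_sum p p J > 0 \<or>
    card {i \<in> {2..8}. \<not> [num_zero_sum p (i * p) J = 0] (mod p)} \<ge> 6"
proof (rule ccontr)
  define S where "S = {i \<in> {2..8}. \<not> [num_zero_sum p (i * p) J = 0] (mod p)}"
  assume "\<not> ?thesis"
  then have N1: "num_zero_sum p p J = 0" and "card S \<le> 5"
    by (auto simp: S_def)
  have S: "finite S" "S \<subseteq> {2..8}"
    by (auto simp: S_def)
  let ?f = "\<lambda>k. (- 1) ^ (k * p) * (\<Prod>s\<in>S. int k - int s) * int (num_zero_sum p (k * p) J)"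
  \<comment> \<open>The degree is at most \<open>4 * (p - 1) + 5 * p = 9 * p - 4\<close>, just one
    below the length of \<open>J\<close>.\<close>
  have "card S * p \<le> 5 * p"
    using \<open>card S \<le> 5\<close> by simp
  then have "4 * (p - 1) + card S * p < length J" "length J < 9 * p"
    using assms(2,3) by linarith+
  then have "[(\<Sum>k<9. ?f k) = 0] (mod int p)"
    using assms(1) S(1) by (intro alternating_num_zero_sum)
  moreover have "[(\<Sum>k<9. ?f k) = (\<Sum>k<9::nat. if k = 0 then \<Prod>s\<in>S. - int s else 0)] (mod int p)"
  proof (intro cong_sum)
    fix k :: nat assume "k \<in> {..<9}"
    \<comment> \<open>Only \<open>k = 0\<close> survives, through the empty subsequence:
      \<open>N1\<close> kills \<open>k = 1\<close>, the weight kills \<open>S\<close>, and the other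
      counts are 0 modulo \<open>p\<close>.\<close>
    then consider "k = 0" | "k = 1" | "k \<in> S" | "k \<noteq> 0" "[num_zero_sum p (k * p) J = 0] (mod p)"
      by (force simp: S_def)
    then show "[?f k = (if k = 0 then \<Prod>s\<in>S. - int s else 0)] (mod int p)"
    proof cases
      case 3
      then have "(\<Prod>s\<in>S. int k - int s) = 0"
        using S(1) by auto
      then show ?thesis
        using 3 S(2) by (cases "k = 0") (simp only: mult_zero_left mult_zero_right, auto)
    next
      case 4
      then show ?thesis
        by (simp add: cong_0_iff)
    qed (auto simp: num_zero_sum_0 N1)
  qed
  ultimately have "int p dvd (\<Prod>s\<in>S. - int s)"
    by (simp add: cong_0_iff cong_dvd_iff)
  then obtain s where "s \<in> S" "p dvd s"
    using assms(1) S(1) by (auto simp: prime_dvd_prod_iff)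
  \<comment> \<open>Since \<open>s\<close> is positive and at most 8 while \<open>p > 7\<close>,
    divisibility leaves only \<open>p = 7 + 1\<close>, which is not prime.\<close>
  then have "s = 8" "p = 8"
    using assms(2) S(2) dvd_imp_le[of p s] by auto
  then show False
    using assms(1) by simp
qed

end
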